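(* Let $G=\{g_0=e,g_1,\dots,g_{n-1}\}$ be a finite group of order $n$ admitted by the PDE $u_t+\mathcal N[u]=0$, $(x,t)\in[a,b]\times[-T,T]$, and suppose that each $g_l\in G$ has the form $g_l\mathbf x=T_{g_l}\mathbf x$, $g_lu=u$, where $\mathbf x=(x,t)^T$ and $T_{g_l}\in\mathbb R^{2\times2}$ is a matrix representation of $g_l$. Let $L\ge2$, let $n_1,\dots,n_{L-1}$ be positive integers, let $\sigma$ be an activation function, and let $\mathbf w_1\in\mathbb R^{n_1\times 2}$, $\mathbf w_l^{(j)}\in\mathbb R^{n_l\times n_{l-1}}$ ($1<l<L$, $0\le j\le n-1$), $\mathbf w_L\in\mathbb R^{1\times n_{L-1}}$, $\mathbf b_l\in\mathbb R^{n_l}$ ($1\le l\le L-1$), $\mathbf b_L\in\mathbb R$ be arbitrary (initialized) weight matrices and biases. Consider the feed-forward neural network with $L-1$ hidden layers, input $\mathbf x^{(0)}=(x,t)^T$, and the following weights and biases. 1) First hidden layer: $$\mathbf W_1=\begin{pmatrix}\mathbf w_1\\ \mathbf w_1T_{g_1}\\ \vdots\\ \mathbf w_1T_{g_{n-1}}\end{pmatrix},\qquad \mathbf B_1=\begin{pmatrix}\mathbf b_1\\ \mathbf b_1\\ \vdots\\ \mathbf b_1\end{pmatrix}.$$ 2) $l$-th hidden layer, $1<l<L$: $$\mathbf W_l=\begin{pmatrix}\widehat{\mathbf W}_l\Lambda_0\\ \widehat{\mathbf W}_l\Lambda_1\\ \vdots\\ \widehat{\mathbf W}_l\Lambda_{n-1}\end{pmatrix},\qquad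 \mathbf B_l=\begin{pmatrix}\mathbf b_l\\ \mathbf b_l\\ \vdots\\ \mathbf b_l\end{pmatrix},\qquad \widehat{\mathbf W}_l=\big(\mathbf w_l^{(0)},\mathbf w_l^{(1)},\dots,\mathbf w_l^{(n-1)}\big),$$ where $\Lambda_j$ is the block permutation matrix associated with $g_j$ in the Cayley table of $G$. 3) Output layer: $\mathbf W_L=(\mathbf w_L,\mathbf w_L,\dots,\mathbf w_L)$ ($n$ copies) and $\mathbf B_L=\mathbf b_L$. Then this network is invariant under $G$: its output satisfies $u(g\,\mathbf x^{(0)})=u(\mathbf x^{(0)})$ for every $g\in G$ and every input $\mathbf x^{(0)}$.
   Context: Here $u=u(x,t)$ is the unknown and $\mathcal N[u]$ denotes a smooth function of $u$ and its $x$-derivatives up to order $r$. A PDE is admitted by (invariant under) $G$ if it is form-preserving under every transformation in $G$. Matrix representation means $T_{g_0}=I$ and $T_{g_ig_j}=T_{g_i}T_{g_j}$. Network evaluation: $Y_1=\sigma(\mathbf W_1\mathbf x^{(0)}+\mathbf B_1)\in\mathbb R^{nn_1}$; for $1<l<L$, $Y_l=\sigma(\mathbf W_lY_{l-1}+\mathbf B_l)\in\mathbb R^{nn_l}$; the output is $u(\mathbf x^{(0)})=\mathbf W_LY_{L-1}+\mathbf B_L\in\mathbb R$. The activation function $\sigma:\mathbb R\to\mathbb R$ is applied componentwise. Block permutation $\Lambda_j$ (acting on vectors consisting of $n$ blocks of size $n_{l-1}$): for $0\le i,j\le n-1$ let $k_i^j$ be the index with $g_ig_j=g_{k_i^j}$;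 then $\Lambda_j\,(y_0,\dots,y_{n-1})^T=(y_{k_0^j},\dots,y_{k_{n-1}^j})^T$ for blocks $y_i\in\mathbb R^{n_{l-1}}$. *)

theory Defs
  imports
    "HOL-Analysis.Derivative"
    "HOL-Analysis.Function_Topology"
    "HOL-Algebra.Coset"
    "Jordan_Normal_Form.Matrix"
begin

hide_const (open) Finite_Cartesian_Product.vec Finite_Cartesian_Product.mat
no_notation Finite_Cartesian_Product.vec_nth (infixl \<open>$\<close> 90)

section \<open>Smooth functions of m real variables\<close>

text \<open>
  The number of variables is a natural number, so Euclidean m-space is represented by the functions
  of type \<^typ>\<open>nat \<Rightarrow> real\<close> that vanish from index m on, with the topology inherited from the
  product topology (which is the usual one on this set).
\<close>

definition Rspace :: "nat \<Rightarrow> (nat \<Rightarrow> real) set" where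
  "Rspace m = {z. \<forall>i\<ge>m. z i = 0}"

text \<open>
  A function is of class k+1 iff it is continuous and its first-order partial derivatives exist and
  are of class k. The values of f outside of Rspace m are irrelevant.
\<close>

primrec Ck :: "nat \<Rightarrow> nat \<Rightarrow> ((nat \<Rightarrow> real) \<Rightarrow> real) \<Rightarrow> bool" where
  "Ck m 0 f \<longleftrightarrow> continuous_on (Rspace m) f"
| "Ck m (Suc k) f \<longleftrightarrow> continuous_on (Rspace m) f \<and>
     (\<forall>i<m. \<exists>f'. (\<forall>z\<in>Rspace m. ((\<lambda>s. f (z(i := s))) has_real_derivative f' z) (at (z i))) \<and> Ck m k f')"

definition smooth :: "nat \<Rightarrow> ((nat \<Rightarrow> real) \<Rightarrow> real) \<Rightarrow> bool" where
  "smooth m f \<longleftrightarrow> (\<forall>k. Ck m k f)"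

definition smooth_plane :: "(real \<times> real \<Rightarrow> real) \<Rightarrow> bool" where
  "smooth_plane u \<longleftrightarrow> smooth 2 (\<lambda>z. u (z 0, z 1))"

section \<open>Evolution equations and their point transformations\<close>

text \<open>
  The left-hand side of the equation \<open>u\<^sub>t + N[u] = 0\<close> at the point (x,t), where
  \<open>N[u] = F(u, u\<^sub>x, \<dots>, \<partial>\<^sub>x\<^sup>r u)\<close>; argument k of F is the k-th x-derivative.
\<close>

definition evolution_lhs ::
  "nat \<Rightarrow> ((nat \<Rightarrow> real) \<Rightarrow> real) \<Rightarrow> (real \<times> real \<Rightarrow> real) \<Rightarrow> real \<times> real \<Rightarrow> real" where
  "evolution_lhs r F u = (\<lambda>(x, t).
     deriv (\<lambda>s. u (x, s)) t
     + F (\<lambda>k. if k \<le> r then (deriv ^^ k) (\<lambda>y. u (y, t)) x else 0))"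

text \<open>
  A transformation \<Phi> of the space of all ((x,t),u) takes a function u to the function v whose graph
  is the image of the graph of u, here required locally at p only. The equation \<open>\<Delta>[u] = 0\<close>
  on the domain D is form-preserving under \<Phi> if in the transformed variables it is again the
  equation \<open>\<Delta>[v] = 0\<close>, that is, if u satisfies it at a point p of D exactly when v satisfies it at
  the image of p. The functions u and v need not be solutions: this is a condition on the equation
  itself (on its locus in the jet space), and it is not empty for equations with few solutions.
\<close>

definition form_preserving ::
  "(real \<times> real) set \<Rightarrow> ((real \<times> real \<Rightarrow> real) \<Rightarrow> real \<times> real \<Rightarrow> real)
   \<Rightarrow> ((real \<times> real) \<times> real \<Rightarrow> (real \<times> real) \<times> real) \<Rightarrow> bool" where
  "form_preserving D \<Delta> \<Phi> \<longleftrightarrow>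
     (\<forall>u v. \<forall>p\<in>D. smooth_plane u \<longrightarrow> smooth_plane v \<longrightarrow>
        (\<forall>\<^sub>F q in nhds p. v (fst (\<Phi> (q, u q))) = snd (\<Phi> (q, u q))) \<longrightarrow>
        (\<Delta> u p = 0 \<longleftrightarrow> \<Delta> v (fst (\<Phi> (p, u p))) = 0))"

definition admitted_by ::
  "('g, 'm) monoid_scheme \<Rightarrow> ('g \<Rightarrow> (real \<times> real) \<times> real \<Rightarrow> (real \<times> real) \<times> real)
   \<Rightarrow> (real \<times> real) set \<Rightarrow> ((real \<times> real \<Rightarrow> real) \<Rightarrow> real \<times> real \<Rightarrow> real) \<Rightarrow> bool" where
  "admitted_by G act D \<Delta> \<longleftrightarrow> (\<forall>h\<in>carrier G. form_preserving D \<Delta> (act h))"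

definition matrix_representation :: "('g, 'm) monoid_scheme \<Rightarrow> nat \<Rightarrow> ('g \<Rightarrow> real mat) \<Rightarrow> bool" where
  "matrix_representation G d T \<longleftrightarrow>
     (\<forall>h\<in>carrier G. T h \<in> carrier_mat d d) \<and>
     T \<one>\<^bsub>G\<^esub> = 1\<^sub>m d \<and>
     (\<forall>h\<in>carrier G. \<forall>k\<in>carrier G. T (h \<otimes>\<^bsub>G\<^esub> k) = T h * T k)"

section \<open>Block matrices\<close>

text \<open>n blocks of size p by q below each other (vstack) or next to each other (hstack); vstack_vec
  is the concatenation of n vectors of length p.\<close>

definition vstack :: "nat \<Rightarrow> nat \<Rightarrow> nat \<Rightarrow> (nat \<Rightarrow> real mat) \<Rightarrow> real mat" where
  "vstack n p q A = mat (n * p) q (\<lambda>(i, j). A (i div p) $$ (i mod p, j))"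

definition hstack :: "nat \<Rightarrow> nat \<Rightarrow> nat \<Rightarrow> (nat \<Rightarrow> real mat) \<Rightarrow> real mat" where
  "hstack n p q A = mat p (n * q) (\<lambda>(i, j). A (j div q) $$ (i, j mod q))"

definition vstack_vec :: "nat \<Rightarrow> nat \<Rightarrow> (nat \<Rightarrow> real vec) \<Rightarrow> real vec" where
  "vstack_vec n p y = vec (n * p) (\<lambda>i. y (i div p) $ (i mod p))"

text \<open>The index k with \<open>g\<^sub>i g\<^sub>j = g\<^sub>k\<close>, for an enumeration g of the elements of G.\<close>

definition cayley_index ::
  "('g, 'm) monoid_scheme \<Rightarrow> (nat \<Rightarrow> 'g) \<Rightarrow> nat \<Rightarrow> nat \<Rightarrow> nat \<Rightarrow> nat" where
  "cayley_index G g n i j = (THE k. k < n \<and> g i \<otimes>\<^bsub>G\<^esub> g j = g k)"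

text \<open>The block permutation matrix of \<open>g\<^sub>j\<close> on n blocks of size p; its action on vectors is
  \<open>block_perm_mult\<close> below.\<close>

definition block_perm ::
  "('g, 'm) monoid_scheme \<Rightarrow> (nat \<Rightarrow> 'g) \<Rightarrow> nat \<Rightarrow> nat \<Rightarrow> nat \<Rightarrow> real mat" where
  "block_perm G g n p j = mat (n * p) (n * p)
     (\<lambda>(s, s'). if s' = cayley_index G g n (s div p) j * p + s mod p then 1 else 0)"

lemma cayley_index:
  assumes "group G" "bij_betw g {..<n} (carrier G)" "i < n" "j < n"
  shows "cayley_index G g n i j < n \<and> g i \<otimes>\<^bsub>G\<^esub> g j = g (cayley_index G g n i j)"
  unfolding cayley_index_def
proof (rule theI')
  interpret group G by fact
  have "g i \<in> carrier G" "g j \<in> carrier G"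
    using assms by (auto dest: bij_betwE)
  then have "g i \<otimes>\<^bsub>G\<^esub> g j \<in> g ` {..<n}"
    using assms(2) by (simp add: bij_betw_def)
  then show "\<exists>!k. k < n \<and> g i \<otimes>\<^bsub>G\<^esub> g j = g k"
    using assms(2) by (force simp: bij_betw_def inj_on_def)
qed

lemma block_perm_mult:
  assumes "group G" "bij_betw g {..<n} (carrier G)" "j < n"
  shows "block_perm G g n p j *\<^sub>v vstack_vec n p y
       = vstack_vec n p (\<lambda>i. y (cayley_index G g n i j))"
proof (rule eq_vecI)
  fix s assume "s < dim_vec (vstack_vec n p (\<lambda>i. y (cayley_index G g n i j)))"
  then have s: "s < n * p" by (simp add: vstack_vec_def)
  then have p: "p > 0" by (cases p) auto
  define k where "k = cayley_index G g n (s div p) j"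
  have "s div p < n" using s by (simp add: less_mult_imp_div_less)
  then have "k < n" using cayley_index[OF assms(1,2) _ assms(3)] by (auto simp: k_def)
  have lt: "k * p + s mod p < n * p"
  proof -
    have "k * p + s mod p < k * p + p" using p by simp
    also have "\<dots> = Suc k * p" by simp
    also have "\<dots> \<le> n * p" using \<open>k < n\<close> by (intro mult_le_mono1) simp
    finally show ?thesis .
  qed
  have "(block_perm G g n p j *\<^sub>v vstack_vec n p y) $ s
      = (\<Sum>i\<in>{0..<n * p}. (if i = k * p + s mod p then 1 else 0) * y (i div p) $ (i mod p))"
    using s by (simp add: block_perm_def vstack_vec_def scalar_prod_def k_def)
  also have "\<dots> = (\<Sum>i\<in>{0..<n * p}. if i = k * p + s mod p then y (i div p) $ (i mod p) else 0)"
    by (rule sum.cong) auto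
  also have "\<dots> = y k $ (s mod p)"
    using lt p by (simp add: sum.delta)
  finally show "(block_perm G g n p j *\<^sub>v vstack_vec n p y) $ s
      = vstack_vec n p (\<lambda>i. y (cayley_index G g n i j)) $ s"
    using s by (simp add: vstack_vec_def k_def)
qed (simp add: block_perm_def vstack_vec_def)

section \<open>Feed-forward networks\<close>

text \<open>Layer 0 is the input, and layer L below is the output layer, to which no activation function
  is applied.\<close>

primrec hidden_layer ::
  "(real \<Rightarrow> real) \<Rightarrow> (nat \<Rightarrow> real mat) \<Rightarrow> (nat \<Rightarrow> real vec) \<Rightarrow> real vec \<Rightarrow> nat \<Rightarrow> real vec" where
  "hidden_layer \<sigma> W B x 0 = x"
| "hidden_layer \<sigma> W B x (Suc l) =
     map_vec \<sigma> (W (Suc l) *\<^sub>v hidden_layer \<sigma> W B x l + B (Suc l))"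

definition network ::
  "(real \<Rightarrow> real) \<Rightarrow> (nat \<Rightarrow> real mat) \<Rightarrow> (nat \<Rightarrow> real vec) \<Rightarrow> nat \<Rightarrow> real vec \<Rightarrow> real" where
  "network \<sigma> W B L x = (W L *\<^sub>v hidden_layer \<sigma> W B x (L - 1) + B L) $ 0"

end

theory Submission
  imports Defs
begin

text \<open>
  Index the blocks of a hidden layer by the elements of G instead of by their numbers. The claim
  propagated through the hidden layers is that transforming the input by h turns the blocks
  \<open>Y k\<close> into the blocks \<open>Y (k h)\<close>. It holds in the first layer because T is a homomorphism. A later
  layer has the blocks \<open>\<sigma> (\<Sum>\<^sub>i w\<^sub>i Y (g\<^sub>i k) + b)\<close>, a left convolution, which commutes with right
  translations by associativity. The output layer sums over all blocks and so forgets the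
  translation.
\<close>

section \<open>Products of block matrices with block vectors\<close>

lemma vstack_vec_cong:
  "(\<And>i. i < n \<Longrightarrow> y i = z i) \<Longrightarrow> vstack_vec n p y = vstack_vec n p z"
  by (rule eq_vecI) (simp_all add: vstack_vec_def less_mult_imp_div_less)

lemma vstack_vec_carrier [simp]: "vstack_vec n p y \<in> carrier_vec (n * p)"
  by (simp add: vstack_vec_def)

lemma hstack_carrier [simp]: "hstack n p q A \<in> carrier_mat p (n * q)"
  by (simp add: hstack_def)

lemma block_perm_carrier [simp]: "block_perm G g n p j \<in> carrier_mat (n * p) (n * p)"
  by (simp add: block_perm_def)

lemma mod_less_block: "s < n * p \<Longrightarrow> s mod p < (p :: nat)"
  by (cases "p = 0") simp_all

lemma vstack_mult_vec:
  assumes "\<And>i. i < n \<Longrightarrow> A i \<in> carrier_mat p q" "x \<in> carrier_vec q"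
  shows "vstack n p q A *\<^sub>v x = vstack_vec n p (\<lambda>i. A i *\<^sub>v x)"
proof (rule eq_vecI)
  fix s assume "s < dim_vec (vstack_vec n p (\<lambda>i. A i *\<^sub>v x))"
  then have s: "s < n * p" by (simp add: vstack_vec_def)
  have A: "A (s div p) \<in> carrier_mat p q"
    using s assms(1) by (simp add: less_mult_imp_div_less)
  show "(vstack n p q A *\<^sub>v x) $ s = vstack_vec n p (\<lambda>i. A i *\<^sub>v x) $ s"
    using s mod_less_block[OF s] A assms(2) by (simp add: vstack_def vstack_vec_def scalar_prod_def)
qed (simp add: vstack_def vstack_vec_def)

text \<open>The scalar product of a row with the concatenated vector is cut into \<open>n\<close>
  pieces of length \<open>q\<close>. The sum of the products is taken entry by entry, because the
  dimension of a \<open>vec\<close> is not part of its type and has to be fixed as \<open>p\<close>,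
  also for \<open>n = 0\<close>.\<close>

lemma hstack_mult_vstack_vec:
  assumes "\<And>i. i < n \<Longrightarrow> A i \<in> carrier_mat p q" "\<And>i. i < n \<Longrightarrow> y i \<in> carrier_vec q"
  shows "hstack n p q A *\<^sub>v vstack_vec n q y = vec p (\<lambda>s. \<Sum>i<n. (A i *\<^sub>v y i) $ s)"
proof (rule eq_vecI)
  fix s assume "s < dim_vec (vec p (\<lambda>s. \<Sum>i<n. (A i *\<^sub>v y i) $ s))"
  then have s: "s < p" by simp
  \<comment> \<open>Term \<open>m\<close> of the scalar product belongs to block
    \<open>m div q\<close>, position \<open>m mod q\<close>.\<close>
  define f where "f m = A (m div q) $$ (s, m mod q) * y (m div q) $ (m mod q)" for m
  have "(hstack n p q A *\<^sub>v vstack_vec n q y) $ s = sum f {..<n * q}"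
    using s by (simp add: hstack_def vstack_vec_def scalar_prod_def f_def lessThan_atLeast0)
  also have "\<dots> = (\<Sum>i<n. sum f {i * q..<i * q + q})"
    by (rule sum.nat_group[symmetric])
  also have "\<dots> = (\<Sum>i<n. (A i *\<^sub>v y i) $ s)"
  proof (rule sum.cong)
    fix i assume "i \<in> {..<n}"
    then have i: "A i \<in> carrier_mat p q" "y i \<in> carrier_vec q"
      using assms by auto
    \<comment> \<open>Shifted to start at 0: for \<open>j < q\<close> the index
      \<open>j + i * q\<close> has quotient \<open>i\<close> and remainder \<open>j\<close>.\<close>
    have "sum f {i * q..<i * q + q} = (\<Sum>j = 0..<q. f (j + i * q))"
      using sum.shift_bounds_nat_ivl[of f 0 "i * q" q] by (simp add: add.commute)
    also have "\<dots> = (\<Sum>j = 0..<q. A i $$ (s, j) * y i $ j)"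
      by (rule sum.cong) (auto simp: f_def)
    also have "\<dots> = (A i *\<^sub>v y i) $ s"
      using s i by (simp add: scalar_prod_def)
    finally show "sum f {i * q..<i * q + q} = (A i *\<^sub>v y i) $ s" .
  qed simp
  finally show "(hstack n p q A *\<^sub>v vstack_vec n q y) $ s
      = vec p (\<lambda>s. \<Sum>i<n. (A i *\<^sub>v y i) $ s) $ s"
    using s by simp
qed (simp add: hstack_def)

lemma map_vec_vstack_vec_add:
  assumes "\<And>i. i < n \<Longrightarrow> y i \<in> carrier_vec p" "\<And>i. i < n \<Longrightarrow> z i \<in> carrier_vec p"
  shows "map_vec f (vstack_vec n p y + vstack_vec n p z) = vstack_vec n p (\<lambda>i. map_vec f (y i + z i))"
proof (rule eq_vecI)
  fix s assume "s < dim_vec (vstack_vec n p (\<lambda>i. map_vec f (y i + z i)))"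
  then have s: "s < n * p" by (simp add: vstack_vec_def)
  then have "dim_vec (y (s div p)) = p" "dim_vec (z (s div p)) = p"
    using assms[of "s div p"] by (auto simp: less_mult_imp_div_less)
  then show "map_vec f (vstack_vec n p y + vstack_vec n p z) $ s
      = vstack_vec n p (\<lambda>i. map_vec f (y i + z i)) $ s"
    using s mod_less_block[OF s] by (simp add: vstack_vec_def)
qed (simp add: vstack_vec_def)

section \<open>Layers as operators on functions on the group\<close>

text \<open>Block \<open>i\<close> is read as the value of a function \<open>Y\<close> at the group
  element \<open>g i\<close>. The Cayley index then disappears, and the block permutation becomes
  right translation of \<open>Y\<close> by \<open>g j\<close>.\<close>

lemma block_perm_mult_group:
  assumes "group G" "bij_betw g {..<n} (carrier G)" "j < n"
  shows "block_perm G g n p j *\<^sub>v vstack_vec n p (\<lambda>i. Y (g i))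
       = vstack_vec n p (\<lambda>i. Y (g i \<otimes>\<^bsub>G\<^esub> g j))"
  unfolding block_perm_mult[OF assms]
  by (rule vstack_vec_cong) (simp add: cayley_index[OF assms(1,2) _ assms(3)])

text \<open>For \<open>k\<close> in the group and m = \<open>g i\<close> k, the weight applied to
  \<open>Y\<close> at m depends only on the quotient of m by k, so this is a group convolution with
  kernel \<open>w\<close>. The argument \<open>k\<close> is a group element, not a block number, so
  that translations need no Cayley table.\<close>

definition left_convolution ::
  "('g, 'm) monoid_scheme \<Rightarrow> (nat \<Rightarrow> 'g) \<Rightarrow> nat \<Rightarrow> nat \<Rightarrow> (nat \<Rightarrow> real mat)
   \<Rightarrow> ('g \<Rightarrow> real vec) \<Rightarrow> 'g \<Rightarrow> real vec" where
  "left_convolution G g n p w Y k = vec p (\<lambda>s. \<Sum>i<n. (w i *\<^sub>v Y (g i \<otimes>\<^bsub>G\<^esub> k)) $ s)"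

lemma left_convolution_carrier [simp]: "left_convolution G g n p w Y k \<in> carrier_vec p"
  by (simp add: left_convolution_def)

text \<open>Weight \<open>w i\<close> meets \<open>Y\<close> at (\<open>g i\<close> k) h on the left
  and at \<open>g i\<close> (k h) on the right.\<close>

lemma left_convolution_translate:
  assumes "group G" "bij_betw g {..<n} (carrier G)" "h \<in> carrier G" "k \<in> carrier G"
  shows "left_convolution G g n p w (\<lambda>k. Y (k \<otimes>\<^bsub>G\<^esub> h)) k
       = left_convolution G g n p w Y (k \<otimes>\<^bsub>G\<^esub> h)"
proof -
  interpret group G by fact
  have "g i \<in> carrier G" if "i < n" for i
    using that assms(2) by (auto dest: bij_betwE)
  then show ?thesis
    using assms(3,4) by (auto simp: left_convolution_def m_assoc intro!: eq_vecI sum.cong)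
qed

text \<open>Since \<open>Y\<close> is an arbitrary function on the group, one formula serves both
  inputs: the original one with \<open>Y\<close>, the transformed one with the right translate of
  \<open>Y\<close> by \<open>h\<close>.\<close>

lemma group_layer:
  assumes "group G" "bij_betw g {..<n} (carrier G)"
    and w: "\<And>i. i < n \<Longrightarrow> w i \<in> carrier_mat p q"
    and b: "b \<in> carrier_vec p"
    and Y: "\<And>k. k \<in> carrier G \<Longrightarrow> Y k \<in> carrier_vec q"
  shows "map_vec \<sigma> (vstack n p (n * q) (\<lambda>j. hstack n p q w * block_perm G g n q j)
            *\<^sub>v vstack_vec n q (\<lambda>i. Y (g i)) + vstack_vec n p (\<lambda>_. b))
       = vstack_vec n p (\<lambda>j. map_vec \<sigma> (left_convolution G g n p w Y (g j) + b))"
proof -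
  interpret group G by fact
  have g: "g i \<in> carrier G" if "i < n" for i
    using that assms(2) by (auto dest: bij_betwE)
  have "vstack n p (n * q) (\<lambda>j. hstack n p q w * block_perm G g n q j)
          *\<^sub>v vstack_vec n q (\<lambda>i. Y (g i))
      = vstack_vec n p (\<lambda>j. (hstack n p q w * block_perm G g n q j) *\<^sub>v vstack_vec n q (\<lambda>i. Y (g i)))"
    by (rule vstack_mult_vec) (auto intro: mult_carrier_mat[OF hstack_carrier])
  also have "\<dots> = vstack_vec n p (\<lambda>j. left_convolution G g n p w Y (g j))"
  proof (rule vstack_vec_cong)
    fix j assume j: "j < n"
    \<comment> \<open>The permutation acts first and turns block \<open>i\<close> into the value of
      \<open>Y\<close> at the product of \<open>g i\<close> and \<open>g j\<close>;
      \<open>w i\<close> then multiplies that block.\<close>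
    have "(hstack n p q w * block_perm G g n q j) *\<^sub>v vstack_vec n q (\<lambda>i. Y (g i))
        = hstack n p q w *\<^sub>v vstack_vec n q (\<lambda>i. Y (g i \<otimes>\<^bsub>G\<^esub> g j))"
      using block_perm_mult_group[OF assms(1,2) j, of q Y]
      by (simp add: assoc_mult_mat_vec[OF hstack_carrier block_perm_carrier])
    also have "\<dots> = left_convolution G g n p w Y (g j)"
      unfolding left_convolution_def
      by (rule hstack_mult_vstack_vec) (use w Y g j in auto)
    finally show "(hstack n p q w * block_perm G g n q j) *\<^sub>v vstack_vec n q (\<lambda>i. Y (g i))
        = left_convolution G g n p w Y (g j)" .
  qed
  finally show ?thesis
    using map_vec_vstack_vec_add[of n "\<lambda>j. left_convolution G g n p w Y (g j)" p "\<lambda>_. b" \<sigma>] b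
    by simp
qed

text \<open>Right multiplication by \<open>h\<close> permutes the group, with right multiplication
  by the inverse of \<open>h\<close> as its inverse map. Passing from the enumeration to the carrier
  avoids tracking the induced permutation of the indices.\<close>

lemma sum_group_translate:
  fixes f :: "'g \<Rightarrow> 'a :: comm_monoid_add"
  assumes "group G" "bij_betw g {..<n} (carrier G)" "h \<in> carrier G"
  shows "(\<Sum>i<n. f (g i \<otimes>\<^bsub>G\<^esub> h)) = (\<Sum>i<n. f (g i))"
proof -
  interpret group G by fact
  have "(\<Sum>i<n. f (g i \<otimes>\<^bsub>G\<^esub> h)) = (\<Sum>k\<in>carrier G. f (k \<otimes>\<^bsub>G\<^esub> h))"
    by (rule sum.reindex_bij_betw[OF assms(2)])
  also have "\<dots> = (\<Sum>k\<in>carrier G. f k)"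
    by (rule sum.reindex_bij_witness[where i = "\<lambda>k. k \<otimes>\<^bsub>G\<^esub> inv\<^bsub>G\<^esub> h" and j = "\<lambda>k. k \<otimes>\<^bsub>G\<^esub> h"])
      (use assms(3) in \<open>auto simp: m_assoc\<close>)
  also have "\<dots> = (\<Sum>i<n. f (g i))"
    by (rule sum.reindex_bij_betw[OF assms(2), symmetric])
  finally show ?thesis .
qed

section \<open>Equivariance of the hidden layers and invariance of the output\<close>

theorem corollary3p2:
  fixes G :: "('g, 'm) monoid_scheme"
    and g :: "nat \<Rightarrow> 'g"
    and act :: "'g \<Rightarrow> (real \<times> real) \<times> real \<Rightarrow> (real \<times> real) \<times> real"
    and T :: "'g \<Rightarrow> real mat"
    and r n L :: nat
    and F :: "(nat \<Rightarrow> real) \<Rightarrow> real"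
    and a b \<tau> :: real
    and d :: "nat \<Rightarrow> nat"
    and \<sigma> :: "real \<Rightarrow> real"
    and w\<^sub>1 w\<^sub>L :: "real mat"
    and w :: "nat \<Rightarrow> nat \<Rightarrow> real mat"
    and bias :: "nat \<Rightarrow> real vec"
    and bias\<^sub>L :: real
    and W :: "nat \<Rightarrow> real mat"
    and B :: "nat \<Rightarrow> real vec"
  assumes group: "group G"
    and order: "finite (carrier G)" "order G = n"
    and enum: "bij_betw g {..<n} (carrier G)" "g 0 = \<one>\<^bsub>G\<^esub>"
    and pde: "smooth (Suc r) F"
    and admitted: "admitted_by G act ({a..b} \<times> {- \<tau>..\<tau>}) (evolution_lhs r F)"
    and rep: "matrix_representation G 2 T"
    and act: "\<forall>h\<in>carrier G. \<forall>x t y. act h ((x, t), y) =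
        (((T h *\<^sub>v vec_of_list [x, t]) $ 0, (T h *\<^sub>v vec_of_list [x, t]) $ 1), y)"
    and L: "L \<ge> 2"
    and widths: "\<forall>l. 1 \<le> l \<and> l < L \<longrightarrow> d l > 0"
    and w\<^sub>1: "w\<^sub>1 \<in> carrier_mat (d 1) 2"
    and w: "\<forall>l j. 1 < l \<and> l < L \<and> j < n \<longrightarrow> w l j \<in> carrier_mat (d l) (d (l - 1))"
    and w\<^sub>L: "w\<^sub>L \<in> carrier_mat 1 (d (L - 1))"
    and bias: "\<forall>l. 1 \<le> l \<and> l < L \<longrightarrow> bias l \<in> carrier_vec (d l)"
    and W_first: "W 1 = vstack n (d 1) 2 (\<lambda>i. w\<^sub>1 * T (g i))"
    and W_hidden: "\<forall>l. 1 < l \<and> l < L \<longrightarrow>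
        W l = vstack n (d l) (n * d (l - 1))
                (\<lambda>j. hstack n (d l) (d (l - 1)) (w l) * block_perm G g n (d (l - 1)) j)"
    and B_hidden: "\<forall>l. 1 \<le> l \<and> l < L \<longrightarrow> B l = vstack_vec n (d l) (\<lambda>_. bias l)"
    and W_last: "W L = hstack n 1 (d (L - 1)) (\<lambda>_. w\<^sub>L)"
    and B_last: "B L = vec_of_list [bias\<^sub>L]"
  shows "\<forall>h\<in>carrier G. \<forall>x\<in>carrier_vec 2. network \<sigma> W B L (T h *\<^sub>v x) = network \<sigma> W B L x"
proof (intro ballI)
  fix h and x :: "real vec"
  assume h: "h \<in> carrier G" and x: "x \<in> carrier_vec 2"
  interpret group G by (rule group)
  let ?H = "hidden_layer \<sigma> W B"
  have g: "g i \<in> carrier G" if "i < n" for i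
    using that enum(1) by (auto dest: bij_betwE)
  have T: "T k \<in> carrier_mat 2 2" if "k \<in> carrier G" for k
    using that rep by (simp add: matrix_representation_def)
  have Tm: "T (k \<otimes>\<^bsub>G\<^esub> h) = T k * T h" if "k \<in> carrier G" for k
    using that h rep by (simp add: matrix_representation_def)
  \<comment> \<open>One function \<open>Y\<close> must describe the layer for both inputs; this is
    what the next layer needs. The induction starts at layer 1, since the bare input has no block
    structure.\<close>
  have equivariant: "\<exists>Y. (\<forall>k\<in>carrier G. Y k \<in> carrier_vec (d l)) \<and>
      ?H x l = vstack_vec n (d l) (\<lambda>i. Y (g i)) \<and>
      ?H (T h *\<^sub>v x) l = vstack_vec n (d l) (\<lambda>i. Y (g i \<otimes>\<^bsub>G\<^esub> h))"
    if "1 \<le> l" "l < L" for l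
    using that
  proof (induction l rule: dec_induct)
    case base
    have b: "bias 1 \<in> carrier_vec (d 1)" "B 1 = vstack_vec n (d 1) (\<lambda>_. bias 1)"
      using bias B_hidden L by auto
    define Y where "Y k = map_vec \<sigma> ((w\<^sub>1 * T k) *\<^sub>v x + bias 1)" for k
    \<comment> \<open>Kept general in \<open>z\<close>, as it is needed for \<open>x\<close> and for
      the transformed input.\<close>
    have first: "?H z 1 = vstack_vec n (d 1) (\<lambda>i. map_vec \<sigma> ((w\<^sub>1 * T (g i)) *\<^sub>v z + bias 1))"
      if z: "z \<in> carrier_vec 2" for z
    proof -
      have wT: "w\<^sub>1 * T (g i) \<in> carrier_mat (d 1) 2" if "i < n" for i
        using w\<^sub>1 T g that by (meson mult_carrier_mat)
      have "?H z 1 = map_vec \<sigma> (W 1 *\<^sub>v z + B 1)"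
        by simp
      also have "W 1 *\<^sub>v z = vstack_vec n (d 1) (\<lambda>i. (w\<^sub>1 * T (g i)) *\<^sub>v z)"
        unfolding W_first by (rule vstack_mult_vec[OF wT z])
      also have "map_vec \<sigma> (\<dots> + B 1)
          = vstack_vec n (d 1) (\<lambda>i. map_vec \<sigma> ((w\<^sub>1 * T (g i)) *\<^sub>v z + bias 1))"
        unfolding b(2)
        by (rule map_vec_vstack_vec_add) (use wT z b(1) in \<open>auto intro: mult_mat_vec_carrier\<close>)
      finally show ?thesis .
    qed
    have "Y k \<in> carrier_vec (d 1)" for k
      by (rule carrier_vecI) (use carrier_vecD[OF b(1)] in \<open>simp add: Y_def\<close>)
    moreover have "?H x 1 = vstack_vec n (d 1) (\<lambda>i. Y (g i))"
      unfolding Y_def by (rule first[OF x])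
    moreover have "?H (T h *\<^sub>v x) 1 = vstack_vec n (d 1) (\<lambda>i. Y (g i \<otimes>\<^bsub>G\<^esub> h))"
    proof -
      \<comment> \<open>The transformation of the input is absorbed into the weights of the
        block.\<close>
      have "(w\<^sub>1 * T (g i)) *\<^sub>v (T h *\<^sub>v x) = (w\<^sub>1 * T (g i \<otimes>\<^bsub>G\<^esub> h)) *\<^sub>v x" if "i < n" for i
      proof -
        have "(w\<^sub>1 * T (g i)) *\<^sub>v (T h *\<^sub>v x) = ((w\<^sub>1 * T (g i)) * T h) *\<^sub>v x"
          using assoc_mult_mat_vec[OF mult_carrier_mat[OF w\<^sub>1 T[OF g[OF that]]] T[OF h] x] by simp
        also have "(w\<^sub>1 * T (g i)) * T h = w\<^sub>1 * T (g i \<otimes>\<^bsub>G\<^esub> h)"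
          using assoc_mult_mat[OF w\<^sub>1 T[OF g[OF that]] T[OF h]] Tm[OF g[OF that]] by simp
        finally show ?thesis .
      qed
      then show ?thesis
        unfolding first[OF mult_mat_vec_carrier[OF T[OF h] x]] Y_def
        by (intro vstack_vec_cong) simp
    qed
    ultimately show ?case by (intro exI[of _ Y] conjI ballI)
  next
    case (step l)
    obtain Y where Y: "\<And>k. k \<in> carrier G \<Longrightarrow> Y k \<in> carrier_vec (d l)"
      and Hx: "?H x l = vstack_vec n (d l) (\<lambda>i. Y (g i))"
      and Hhx: "?H (T h *\<^sub>v x) l = vstack_vec n (d l) (\<lambda>i. Y (g i \<otimes>\<^bsub>G\<^esub> h))"
      using step.IH[OF Suc_lessD[OF step.prems]] by meson
    define Z where "Z k = map_vec \<sigma> (left_convolution G g n (d (Suc l)) (w (Suc l)) Y k + bias (Suc l))"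
      for k
    have l: "1 < Suc l" "Suc l < L" using step by auto
    have b: "bias (Suc l) \<in> carrier_vec (d (Suc l))" using bias l by simp
    have w': "w (Suc l) i \<in> carrier_mat (d (Suc l)) (d l)" if "i < n" for i
      using w[rule_format, of "Suc l" i] l that by simp
    have W: "W (Suc l) = vstack n (d (Suc l)) (n * d l)
        (\<lambda>j. hstack n (d (Suc l)) (d l) (w (Suc l)) * block_perm G g n (d l) j)"
      using W_hidden[rule_format, of "Suc l"] l by simp
    have B: "B (Suc l) = vstack_vec n (d (Suc l)) (\<lambda>_. bias (Suc l))"
      using B_hidden l by simp
    note layer = group_layer[where w = "w (Suc l)" and \<sigma> = \<sigma>, OF group enum(1) w' b]
    have "Z k \<in> carrier_vec (d (Suc l))" for k
      by (rule carrier_vecI) (use carrier_vecD[OF b] in \<open>simp add: Z_def\<close>)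
    moreover have "?H x (Suc l) = vstack_vec n (d (Suc l)) (\<lambda>i. Z (g i))"
      unfolding hidden_layer.simps W B Hx Z_def by (rule layer) (use Y in auto)
    moreover have "?H (T h *\<^sub>v x) (Suc l) = vstack_vec n (d (Suc l)) (\<lambda>i. Z (g i \<otimes>\<^bsub>G\<^esub> h))"
    proof -
      have "?H (T h *\<^sub>v x) (Suc l) = vstack_vec n (d (Suc l)) (\<lambda>j. map_vec \<sigma>
          (left_convolution G g n (d (Suc l)) (w (Suc l)) (\<lambda>k. Y (k \<otimes>\<^bsub>G\<^esub> h)) (g j) + bias (Suc l)))"
        unfolding hidden_layer.simps W B Hhx
        by (rule layer[of "\<lambda>k. Y (k \<otimes>\<^bsub>G\<^esub> h)"]) (use Y h in auto)
      \<comment> \<open>The translation moves out of \<open>Y\<close> into the argument of the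
        convolution; bias and activation are the same in every block and do not disturb it.\<close>
      also have "\<dots> = vstack_vec n (d (Suc l)) (\<lambda>i. Z (g i \<otimes>\<^bsub>G\<^esub> h))"
        unfolding Z_def
        by (rule vstack_vec_cong) (simp add: left_convolution_translate[OF group enum(1) h] g)
      finally show ?thesis .
    qed
    ultimately show ?case by (intro exI[of _ Z] conjI ballI)
  qed
  \<comment> \<open>By \<open>L \<ge> 2\<close> the layer feeding the output is a genuine hidden
    layer.\<close>
  have "1 \<le> L - 1" "L - 1 < L" using L by auto
  then obtain Y where Y: "\<And>k. k \<in> carrier G \<Longrightarrow> Y k \<in> carrier_vec (d (L - 1))"
    and Hx: "?H x (L - 1) = vstack_vec n (d (L - 1)) (\<lambda>i. Y (g i))"
    and Hhx: "?H (T h *\<^sub>v x) (L - 1) = vstack_vec n (d (L - 1)) (\<lambda>i. Y (g i \<otimes>\<^bsub>G\<^esub> h))"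
    using equivariant by meson
  \<comment> \<open>All blocks share the output weight \<open>w\<^sub>L\<close>, so the product is a
    plain sum over the group.\<close>
  have "W L *\<^sub>v ?H (T h *\<^sub>v x) (L - 1) = vec 1 (\<lambda>s. \<Sum>i<n. (w\<^sub>L *\<^sub>v Y (g i \<otimes>\<^bsub>G\<^esub> h)) $ s)"
    unfolding W_last Hhx by (rule hstack_mult_vstack_vec) (use w\<^sub>L Y g h in auto)
  also have "\<dots> = vec 1 (\<lambda>s. \<Sum>i<n. (w\<^sub>L *\<^sub>v Y (g i)) $ s)"
    \<comment> \<open>The dummy \<open>_\<close> leaves the entry open, so that the rewriting works
      below the binder of \<open>s\<close>.\<close>
    by (simp only: sum_group_translate[OF group enum(1) h, of "\<lambda>k. (w\<^sub>L *\<^sub>v Y k) $ _"])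
  also have "\<dots> = W L *\<^sub>v ?H x (L - 1)"
    unfolding W_last Hx by (rule hstack_mult_vstack_vec[symmetric]) (use w\<^sub>L Y g in auto)
  finally show "network \<sigma> W B L (T h *\<^sub>v x) = network \<sigma> W B L x"
    by (simp add: network_def)
qed

end
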